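(* Let $n\ge1$ be an integer. The cubature formula $$6\int_{\triangle^*}f(x_1,x_2,x_3)\,dx_1dx_2dx_3=\frac1{4n^3}\sum_{0\le k_3\le k_2\le k_1\le n}\lambda^{(n)}_{k_1,k_2,k_3}\,f(\tfrac{k_1}n,\tfrac{k_2}n,\tfrac{k_3}n)$$ is exact for every function $f$ on $\triangle^*$ such that the function $\mathbf t\mapsto f(t_1-t_4,t_2-t_4,t_3-t_4)$ on $\triangle_H$ belongs to $\mathcal{TC}_{2n-1}$.
   Context: $\triangle^*=\{x\in\mathbb R^3: 0\le x_3\le x_2\le x_1\le1\}$. Let $\mathbb R^4_H=\{\mathbf t\in\mathbb R^4: t_1+t_2+t_3+t_4=0\}$, $\mathbb Z^4_H=\mathbb Z^4\cap\mathbb R^4_H$, $\mathbb H=\{\mathbf k\in\mathbb Z^4_H: k_1\equiv k_2\equiv k_3\equiv k_4\pmod4\}$, $\phi_{\mathbf k}(\mathbf t)=e^{\frac{\pi i}{2}\mathbf k\cdot\mathbf t}$, $\mathsf{TC}_{\mathbf k}(\mathbf t)=\frac1{24}\sum_{\sigma\in S_4}\phi_{\mathbf k}(\mathbf t\sigma)$ where $\mathbf t\sigma$ permutes coordinates. $\triangle_H=\{\mathbf t\in\mathbb R^4_H: t_1-t_2,\,t_2-t_3,\,t_3-t_4,\,t_1-t_4\in[0,1]\}$, and $\mathcal{TC}_m=\operatorname{span}\{\mathsf{TC}_{\mathbf k}:\mathbf k\in\mathbb H,\ k_4\le k_3\le k_2\le k_1\le k_4+4m\}$. The weights: $\lambda^{(n)}_{k_1,k_2,k_3}=24$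 if none of the relations (a) $k_1=k_2$, (b) $k_2=k_3$, (c) $k_3=0$, (d) $k_1=n$ holds; $12$ if exactly one holds; $6$ if exactly two hold and they are $\{(a),(c)\}$ or $\{(b),(d)\}$; $4$ if exactly two other ones hold; $1$ if three hold. (Equivalently $\lambda^{(n)}_{k}=\lambda^{(n)}_{\mathbf j}$ for the $\mathbf j\in\mathbb H$ with $k_i=\frac14(j_i-j_4)$, $i=1,2,3$.) *)

theory Defs
  imports "HOL-Analysis.Analysis"
begin

text \<open>Points of R^4 are modelled as real^4, with coordinates t$1, t$2, t$3, t$4
  (in the numeral type 4 the numeral 4 equals 0, so these are the four distinct indices).\<close>

definition tri_star :: "(real^3) set" where
  "tri_star = {x. 0 \<le> x$3 \<and> x$3 \<le> x$2 \<and> x$2 \<le> x$1 \<and> x$1 \<le> 1}"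

definition RH :: "(real^4) set" where
  "RH = {t. t$1 + t$2 + t$3 + t$4 = 0}"

definition HH :: "(int^4) set" where
  "HH = {k. k$1 + k$2 + k$3 + k$4 = 0 \<and>
            k$1 mod 4 = k$2 mod 4 \<and> k$2 mod 4 = k$3 mod 4 \<and> k$3 mod 4 = k$4 mod 4}"

definition phi :: "int^4 \<Rightarrow> real^4 \<Rightarrow> complex" where
  "phi k t = exp (complex_of_real (pi / 2 * (\<Sum>i\<in>UNIV. of_int (k$i) * t$i)) * \<i>)"

definition permv :: "real^4 \<Rightarrow> (4 \<Rightarrow> 4) \<Rightarrow> real^4" where
  "permv t \<sigma> = (\<chi> i. t $ (\<sigma> i))"

definition TC :: "int^4 \<Rightarrow> real^4 \<Rightarrow> complex" where
  "TC k t = (1/24) * (\<Sum>\<sigma>\<in>{\<sigma>. \<sigma> permutes (UNIV :: 4 set)}. phi k (permv t \<sigma>))"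

definition tri_H :: "(real^4) set" where
  "tri_H = {t\<in>RH. t$1 - t$2 \<in> {0..1} \<and> t$2 - t$3 \<in> {0..1} \<and>
                  t$3 - t$4 \<in> {0..1} \<and> t$1 - t$4 \<in> {0..1}}"

definition TC_index :: "nat \<Rightarrow> (int^4) set" where
  "TC_index m = {k\<in>HH. k$4 \<le> k$3 \<and> k$3 \<le> k$2 \<and> k$2 \<le> k$1 \<and> k$1 \<le> k$4 + 4 * int m}"

text \<open>The complex linear span of {TC_k : k in TC_index m} (TC_index m is finite),
  written out as the set of linear combinations.\<close>
definition TC_space :: "nat \<Rightarrow> (real^4 \<Rightarrow> complex) set" where
  "TC_space m = {g. \<exists>c :: int^4 \<Rightarrow> complex. \<forall>t. g t = (\<Sum>k\<in>TC_index m. c k * TC k t)}"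

text \<open>Weights lambda^(n)_{k1,k2,k3}. The case where all four relations hold
  cannot occur for n \<ge> 1 and 0 \<le> k3 \<le> k2 \<le> k1 \<le> n; it is given value 1 arbitrarily.\<close>
definition lam :: "nat \<Rightarrow> nat \<Rightarrow> nat \<Rightarrow> nat \<Rightarrow> real" where
  "lam n k1 k2 k3 =
    (let a = (k1 = k2); b = (k2 = k3); c = (k3 = 0); d = (k1 = n);
         cnt = card {i::nat. i < 4 \<and> [a, b, c, d] ! i} in
     if cnt = 0 then 24
     else if cnt = 1 then 12
     else if cnt = 2 then (if (a \<and> c) \<or> (b \<and> d) then 6 else 4)
     else 1)"

end

theory Submission
  imports Defs
begin

text \<open>
  In the coordinates \<open>x = t\<^sub>1 - t\<^sub>4\<close>, \<open>y = t\<^sub>2 - t\<^sub>4\<close>, \<open>z = t\<^sub>3 - t\<^sub>4\<close> the function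
  \<open>TC k\<close> is a symmetric trigonometric function of \<open>(x, y, z)\<close>, and both sides of the formula equal 1
  for \<open>k = 0\<close> and 0 for the other indices.
  By symmetry six times the integral over the tetrahedron is the integral over the unit cube, a sum over
  \<open>\<sigma>\<close> of products of one-dimensional integrals. If \<open>4\<close> divides the \<open>k\<^sub>i\<close>, these vanish unless
  \<open>k = 0\<close>; otherwise the sum is a multiple of \<open>\<Sum>\<^sub>\<sigma> 1/(k\<^bsub>\<sigma>1\<^esub> k\<^bsub>\<sigma>2\<^esub> k\<^bsub>\<sigma>3\<^esub>)\<close>,
  that is of \<open>(k\<^sub>1 + k\<^sub>2 + k\<^sub>3 + k\<^sub>4)/(k\<^sub>1 k\<^sub>2 k\<^sub>3 k\<^sub>4) = 0\<close>.
  On the discrete side, cyclically permuting the vertices of the tetrahedron preserves the weights and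
  multiplies \<open>TC k\<close> by \<open>\<omega> = \<i> ^ k\<^sub>4\<close>, so the sum vanishes if \<open>\<omega> \<noteq> 1\<close>. If \<open>\<omega> = 1\<close>, the weights may be
  replaced by others with the same average over the cycle, chosen so that the sum becomes one over
  the cube and factors into geometric sums; it vanishes unless \<open>4n\<close> divides every \<open>k\<^sub>i\<close>, which for
  \<open>k\<^sub>1 - k\<^sub>4 \<le> 4(2n - 1)\<close> forces \<open>k = 0\<close>.
\<close>

section \<open>Lebesgue measure on \<open>real^'n\<close> as a product measure, and its invariance
  under coordinate permutations\<close>

lemma prod_Basis_vec:
  "(\<Prod>b\<in>(Basis :: (real^'n) set). F b) = (\<Prod>i\<in>UNIV. F (axis i 1))"
  by (rule prod.reindex_bij_witness[where i="\<lambda>i. axis i 1" and j=axis_index])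
    (auto simp: axis_index_axis Basis_vec_def)

lemma measurable_vec_lambda:
  "vec_lambda \<in> measurable (\<Pi>\<^sub>M i\<in>(UNIV::'n::finite set). lborel) (borel :: (real^'n) measure)"
  by (subst borel_measurable_euclidean_space) (auto simp: Basis_vec_def inner_axis)

text \<open>Both measures give a box the product of its side lengths, which determines Lebesgue
  measure. Indexing the product by coordinates makes Fubini available for products of one-variable
  functions.\<close>

lemma lborel_vec_eq_distr_PiM:
  "(lborel :: (real^'n) measure) = distr (\<Pi>\<^sub>M i\<in>UNIV. lborel) borel vec_lambda"
proof (rule lborel_eqI)
  interpret finite_product_sigma_finite "\<lambda>_::'n. lborel :: real measure" UNIV
    by standard auto
  fix l u :: "real^'n"
  assume le: "\<And>b. b \<in> Basis \<Longrightarrow> l \<bullet> b \<le> u \<bullet> b"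
  have le': "l $ i \<le> u $ i" for i
    using le[of "axis i 1"] by (simp add: inner_axis)
  have "emeasure (distr (\<Pi>\<^sub>M i\<in>UNIV. lborel) borel vec_lambda) (box l u)
      = emeasure (\<Pi>\<^sub>M i\<in>UNIV. lborel) (PiE UNIV (\<lambda>i. {l $ i <..< u $ i}))"
    by (subst emeasure_distr[OF measurable_vec_lambda])
      (auto simp: space_PiM mem_box_cart PiE_def Pi_def intro!: arg_cong[where f="emeasure _"])
  also have "\<dots> = (\<Prod>i\<in>UNIV. ennreal (u $ i - l $ i))"
    by (subst emeasure_PiM) (auto simp: le')
  also have "\<dots> = ennreal (\<Prod>i\<in>UNIV. u $ i - l $ i)"
    by (simp add: prod_ennreal le')
  also have "(\<Prod>i\<in>UNIV. u $ i - l $ i) = (\<Prod>b\<in>Basis. (u - l) \<bullet> b)"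
    by (simp add: prod_Basis_vec inner_axis)
  finally show "emeasure (distr (\<Pi>\<^sub>M i\<in>UNIV. lborel) borel vec_lambda) (box l u)
      = (\<Prod>b\<in>Basis. (u - l) \<bullet> b)" .
qed simp

lemma integral_lborel_vec_prod:
  fixes h :: "'n::finite \<Rightarrow> real \<Rightarrow> complex"
  assumes "\<And>i. integrable lborel (h i)"
  shows "(\<integral>x. (\<Prod>i\<in>UNIV. h i (x $ i)) \<partial>(lborel :: (real^'n) measure))
       = (\<Prod>i\<in>UNIV. \<integral>x. h i x \<partial>lborel)"
proof -
  interpret product_sigma_finite "\<lambda>_::'n. lborel :: real measure"
    by standard
  have [measurable]: "h i \<in> borel_measurable borel" for i
    using borel_measurable_integrable[OF assms[of i]] by simp
  show ?thesis
    by (subst lborel_vec_eq_distr_PiM, subst integral_distr[OF measurable_vec_lambda])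
      (simp_all add: product_integral_prod assms)
qed

text \<open>The preimage of a box is a box with the same sides in another order, hence of the same
  volume.\<close>

lemma distr_lborel_permute_vec:
  fixes p :: "'n::finite \<Rightarrow> 'n"
  assumes p: "p permutes UNIV"
  shows "distr lborel borel (\<lambda>x. \<chi> i. x $ p i) = (lborel :: (real^'n) measure)"
proof (rule lborel_eqI[symmetric])
  have m: "(\<lambda>x. \<chi> i. x $ p i) \<in> measurable lborel (borel :: (real^'n) measure)"
    by (auto intro!: borel_measurable_continuous_onI continuous_intros)
  fix l u :: "real^'n"
  assume le: "\<And>b. b \<in> Basis \<Longrightarrow> l \<bullet> b \<le> u \<bullet> b"
  have le': "l $ i \<le> u $ i" for i
    using le[of "axis i 1"] by (simp add: inner_axis)
  have "emeasure (distr lborel borel (\<lambda>x. \<chi> i. x $ p i)) (box l u)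
      = emeasure lborel (box (\<chi> i. l $ inv p i) (\<chi> i. u $ inv p i))"
  proof (subst emeasure_distr[OF m], simp, rule arg_cong[where f="emeasure _"])
    show "(\<lambda>x. \<chi> i. x $ p i) -` box l u \<inter> space lborel = box (\<chi> i. l $ inv p i) (\<chi> i. u $ inv p i)"
      by (auto simp: mem_box_cart)
        (metis p permutes_inverses)+
  qed
  also have "\<dots> = (\<Prod>b\<in>Basis. (((\<chi> i. u $ inv p i)) - (\<chi> i. l $ inv p i)) \<bullet> b)"
    by (rule emeasure_lborel_box) (auto simp: Basis_vec_def inner_axis le')
  also have "\<dots> = (\<Prod>i\<in>UNIV. u $ inv p i - l $ inv p i)"
    by (simp add: prod_Basis_vec inner_axis)
  also have "(\<Prod>i\<in>UNIV. u $ inv p i - l $ inv p i) = (\<Prod>b\<in>Basis. (u - l) \<bullet> b)"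
    using prod.permute[OF permutes_inv[OF p], of "\<lambda>i. u $ i - l $ i"]
    by (simp add: prod_Basis_vec inner_axis o_def)
  finally show "emeasure (distr lborel borel (\<lambda>x. \<chi> i. x $ p i)) (box l u)
      = (\<Prod>b\<in>Basis. (u - l) \<bullet> b)" .
qed simp

section \<open>Generalized cosines in the coordinates of the tetrahedron\<close>

definition TC_star :: "int^4 \<Rightarrow> real \<Rightarrow> real \<Rightarrow> real \<Rightarrow> complex" where
  "TC_star k x y z = (1/24) * (\<Sum>\<sigma>\<in>{\<sigma>. \<sigma> permutes (UNIV :: 4 set)}.
     cis (pi / 2 * (of_int (k $ \<sigma> 1) * x + of_int (k $ \<sigma> 2) * y + of_int (k $ \<sigma> 3) * z)))"

lemma HH_sum_permute:
  assumes "k \<in> HH" "\<sigma> permutes UNIV"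
  shows "k $ \<sigma> 1 + k $ \<sigma> 2 + k $ \<sigma> 3 + k $ \<sigma> 4 = 0"
  using assms(1) sum.permute[OF assms(2), of "\<lambda>i. k $ i"]
  by (simp add: HH_def sum_4 o_def)

lemma HH_mod_4:
  assumes "k \<in> HH"
  shows "k $ i mod 4 = k $ j mod 4"
proof -
  have "\<forall>i. k $ i mod 4 = k $ 4 mod 4"
    using assms by (auto simp: HH_def forall_4)
  thus ?thesis by metis
qed

text \<open>Passing to inverse permutations moves the action from \<open>t\<close> to
  \<open>k\<close>. Since the entries of \<open>k\<close> sum to 0, subtracting \<open>t $ 4\<close>
  from every coordinate leaves the phase unchanged.\<close>

lemma TC_eq_TC_star:
  assumes k: "k \<in> HH"
  shows "TC k t = TC_star k (t $ 1 - t $ 4) (t $ 2 - t $ 4) (t $ 3 - t $ 4)"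
proof -
  have "phi k (permv t (inv \<sigma>)) = cis (pi / 2 * (of_int (k $ \<sigma> 1) * (t $ 1 - t $ 4)
      + of_int (k $ \<sigma> 2) * (t $ 2 - t $ 4) + of_int (k $ \<sigma> 3) * (t $ 3 - t $ 4)))"
    if \<sigma>: "\<sigma> permutes UNIV" for \<sigma>
  proof -
    have "(\<Sum>i\<in>UNIV. of_int (k $ i) * t $ inv \<sigma> i) = (\<Sum>i\<in>UNIV. of_int (k $ \<sigma> i) * t $ i)"
      using sum.permute[OF \<sigma>, of "\<lambda>i. of_int (k $ i) * t $ inv \<sigma> i"] permutes_inverses[OF \<sigma>]
      by (simp add: o_def)
    also have "\<dots> = of_int (k $ \<sigma> 1) * (t $ 1 - t $ 4) + of_int (k $ \<sigma> 2) * (t $ 2 - t $ 4)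
       + of_int (k $ \<sigma> 3) * (t $ 3 - t $ 4)
       + of_int (k $ \<sigma> 1 + k $ \<sigma> 2 + k $ \<sigma> 3 + k $ \<sigma> 4) * t $ 4"
      by (simp add: sum_4 algebra_simps)
    finally show ?thesis
      using HH_sum_permute[OF k \<sigma>] by (simp add: phi_def permv_def cis_conv_exp mult.commute)
  qed
  thus ?thesis
    unfolding TC_def TC_star_def
    by (subst sum_permutations_inverse) (auto intro!: sum.cong)
qed

text \<open>Composing with a transposition only reindexes the sum over the group. This swap and the
  next generate all permutations of the three arguments, which is what both symmetrizations below
  rely on.\<close>

lemma TC_star_swap12: "TC_star k y x z = TC_star k x y z"
  unfolding TC_star_def
  by (subst sum_permutations_compose_right[of "Transposition.transpose 1 2"])
    (simp_all add: permutes_swap_id Transposition.transpose_def ac_simps)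

lemma TC_star_swap23: "TC_star k x z y = TC_star k x y z"
  unfolding TC_star_def
  by (subst sum_permutations_compose_right[of "Transposition.transpose 2 3"])
    (simp_all add: permutes_swap_id Transposition.transpose_def ac_simps)

lemma TC_star_0: "TC_star 0 x y z = 1"
proof -
  have "card {\<sigma>. \<sigma> permutes (UNIV :: 4 set)} = 24"
    by (subst card_permutations[where n=4]) (simp_all add: fact_numeral)
  thus ?thesis by (simp add: TC_star_def)
qed

lemma cis_quarter_cong:
  assumes "a mod 4 = b mod 4"
  shows "cis (pi / 2 * of_int a) = cis (pi / 2 * of_int b)"
proof -
  obtain c where c: "a = b + 4 * c"
    using assms by (metis add_diff_cancel_left' diff_add_cancel dvdE mod_eq_dvd_iff add.commute)
  have "pi / 2 * of_int a = pi / 2 * of_int b + 2 * pi * of_int c"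
    by (simp add: c algebra_simps)
  hence "cis (pi / 2 * of_int a) = cis (pi / 2 * of_int b) * cis (2 * pi * of_int c)"
    by (simp only: cis_mult)
  thus ?thesis
    by (simp add: cis_multiple_2pi)
qed

lemma cis_quarter_eq_1_iff: "cis (pi / 2 * of_int a) = 1 \<longleftrightarrow> 4 dvd a"
proof
  assume "4 dvd a"
  thus "cis (pi / 2 * of_int a) = 1"
    using cis_quarter_cong[of a 0] by auto
next
  assume "cis (pi / 2 * of_int a) = 1"
  then obtain m :: int where "pi / 2 * of_int a = of_int m * 2 * pi"
    by (auto simp: complex_eq_iff cos_one_2pi_int)
  hence "real_of_int a = real_of_int (4 * m)"
    by (simp add: field_simps)
  hence "a = 4 * m" by (simp only: of_int_eq_iff)
  thus "4 dvd a" by simp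
qed

section \<open>The cyclic symmetry of the tetrahedron and the discrete sum\<close>

text \<open>The affine map cyclically permuting the vertices of the tetrahedron, in units of \<open>1/n\<close>;
  it maps the faces \<open>x = n\<close>, \<open>x = y\<close>, \<open>y = z\<close>, \<open>z = 0\<close> cyclically into each other.\<close>
definition vertex_cycle :: "nat \<Rightarrow> nat \<times> nat \<times> nat \<Rightarrow> nat \<times> nat \<times> nat" where
  "vertex_cycle n = (\<lambda>(x, y, z). (n - z, x - z, y - z))"

abbreviation tri_index :: "nat \<Rightarrow> (nat \<times> nat \<times> nat) set" where
  "tri_index n \<equiv> {(x, y, z). z \<le> y \<and> y \<le> x \<and> x \<le> n}"

definition TC_node :: "nat \<Rightarrow> int^4 \<Rightarrow> nat \<times> nat \<times> nat \<Rightarrow> complex" where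
  "TC_node n k = (\<lambda>(x, y, z). TC_star k (real x / real n) (real y / real n) (real z / real n))"

lemma finite_tri_index [simp]: "finite (tri_index n)"
  by (rule finite_subset[of _ "{..n} \<times> {..n} \<times> {..n}"]) auto

lemma vertex_cycle_4:
  "p \<in> tri_index n \<Longrightarrow> vertex_cycle n (vertex_cycle n (vertex_cycle n (vertex_cycle n p))) = p"
  by (auto simp: vertex_cycle_def)

lemma vertex_cycle_in: "p \<in> tri_index n \<Longrightarrow> vertex_cycle n p \<in> tri_index n"
  by (auto simp: vertex_cycle_def)

lemma sum_vertex_cycle: "(\<Sum>p\<in>tri_index n. g (vertex_cycle n p)) = (\<Sum>p\<in>tri_index n. g p)"
  by (rule sum.reindex_bij_witness[where j="vertex_cycle n"
      and i="\<lambda>p. vertex_cycle n (vertex_cycle n (vertex_cycle n p))"])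
    (simp_all add: vertex_cycle_4 vertex_cycle_in del: mem_Collect_eq)

text \<open>After reindexing, the coefficient of \<open>z\<close> is minus the sum of three entries
  of \<open>k\<close>, which is the remaining entry. The leftover phase
  \<open>k $ \<sigma> 4\<close> does not depend on \<open>\<sigma>\<close>, because all entries
  agree modulo 4.\<close>

lemma TC_star_rotate:
  assumes k: "k \<in> HH"
  shows "TC_star k (1 - z) (x - z) (y - z) = cis (pi / 2 * of_int (k $ 4)) * TC_star k x y z"
proof -
  \<comment> \<open>The 4-cycle that pairs \<open>1 - z\<close>, \<open>x - z\<close>,
    \<open>y - z\<close> with the entries at \<open>\<sigma> 4\<close>, \<open>\<sigma> 1\<close>,
    \<open>\<sigma> 2\<close>.\<close>
  define q :: "4 \<Rightarrow> 4" where "q = Transposition.transpose 3 4 \<circ> Transposition.transpose 2 3 \<circ> Transposition.transpose 1 2"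
  have qp: "q permutes UNIV"
    unfolding q_def by (intro permutes_compose permutes_swap_id) auto
  have q: "q 1 = 4" "q 2 = 1" "q 3 = 2" "q 4 = 3"
    by (simp_all add: q_def Transposition.transpose_def)
  have "cis (pi / 2 * (of_int (k $ \<sigma> 4) * (1 - z) + of_int (k $ \<sigma> 1) * (x - z) + of_int (k $ \<sigma> 2) * (y - z)))
      = cis (pi / 2 * of_int (k $ 4)) *
        cis (pi / 2 * (of_int (k $ \<sigma> 1) * x + of_int (k $ \<sigma> 2) * y + of_int (k $ \<sigma> 3) * z))"
    if \<sigma>: "\<sigma> permutes UNIV" for \<sigma>
  proof -
    have k3: "k $ \<sigma> 3 = - k $ \<sigma> 1 - k $ \<sigma> 2 - k $ \<sigma> 4"
      using HH_sum_permute[OF k \<sigma>] by simp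
    have "cis (pi / 2 * of_int (k $ 4)) = cis (pi / 2 * of_int (k $ \<sigma> 4))"
      by (intro cis_quarter_cong HH_mod_4 k)
    thus ?thesis
      by (simp add: cis_mult k3 algebra_simps)
  qed
  thus ?thesis
    unfolding TC_star_def
    by (subst sum_permutations_compose_right[OF qp]) (simp add: q sum_distrib_left)
qed

lemma TC_node_vertex_cycle:
  assumes "k \<in> HH" "n \<ge> 1" "p \<in> tri_index n"
  shows "TC_node n k (vertex_cycle n p) = cis (pi / 2 * of_int (k $ 4)) * TC_node n k p"
proof -
  obtain x y z where p: "p = (x, y, z)" "z \<le> y" "y \<le> x" "x \<le> n"
    using assms(3) by auto
  show ?thesis
    using assms(2) p TC_star_rotate[OF assms(1), of "real z / real n" "real x / real n" "real y / real n"]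
    by (simp add: TC_node_def vertex_cycle_def of_nat_diff diff_divide_distrib)
qed

lemma lam_eq:
  "lam n x y z =
    (let c = of_bool (x = y) + of_bool (y = z) + of_bool (z = 0) + of_bool (x = n) in
     if c = (0::nat) then 24 else if c = 1 then 12
     else if c = 2 then (if (x = y \<and> z = 0) \<or> (y = z \<and> x = n) then 6 else 4) else 1)"
proof -
  have "card {i::nat. i < 4 \<and> [a, b, c, d] ! i} = of_bool a + of_bool b + of_bool c + of_bool d"
    for a b c d
  proof -
    have "card {i::nat. i < 4 \<and> [a, b, c, d] ! i} = (\<Sum>i<4. of_bool ([a, b, c, d] ! i))"
      by (simp add: sum_of_bool_eq lessThan_def Collect_conj_eq)
    also have "\<dots> = of_bool a + of_bool b + of_bool c + of_bool d"
      by (simp add: eval_nat_numeral)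
    finally show ?thesis by simp
  qed
  thus ?thesis unfolding lam_def Let_def by simp
qed

text \<open>Four times the number of orderings of the triple, restricted to the half-open cube: summing over
  the tetrahedron with these weights is four times summing over the fundamental cube \<open>{0..<n}\<^sup>3\<close>.\<close>
definition cube_weight :: "nat \<Rightarrow> nat \<times> nat \<times> nat \<Rightarrow> real" where
  "cube_weight n = (\<lambda>(x, y, z). if x = n then 0 else if x = y \<and> y = z then 4
     else if x = y \<or> y = z then 12 else 24)"

text \<open>The vertex cycle shifts the four boundary relations cyclically, so all weights involved
  are decided by the truth values of these relations at the starting point, and a finite case check
  remains.\<close>

lemma lam_eq_average:
  assumes n: "n \<ge> 1" and p: "(x, y, z) \<in> tri_index n"
  shows "4 * lam n x y z = cube_weight n (x, y, z) + cube_weight n (vertex_cycle n (x, y, z))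
     + cube_weight n (vertex_cycle n (vertex_cycle n (x, y, z)))
     + cube_weight n (vertex_cycle n (vertex_cycle n (vertex_cycle n (x, y, z))))"
proof -
  have step: "\<exists>x' y' z'. vertex_cycle n (x, y, z) = (x', y', z') \<and> z' \<le> y' \<and> y' \<le> x' \<and> x' \<le> n \<and>
      (x' = y' \<longleftrightarrow> x = n) \<and> (y' = z' \<longleftrightarrow> x = y) \<and> (z' = 0 \<longleftrightarrow> y = z) \<and> (x' = n \<longleftrightarrow> z = 0)"
    if "z \<le> y" "y \<le> x" "x \<le> n" for x y z
    using n that by (auto simp: vertex_cycle_def)
  have xyz: "z \<le> y" "y \<le> x" "x \<le> n" using p by auto
  obtain x1 y1 z1 where 1: "vertex_cycle n (x, y, z) = (x1, y1, z1)" "z1 \<le> y1" "y1 \<le> x1" "x1 \<le> n"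
      "x1 = y1 \<longleftrightarrow> x = n" "y1 = z1 \<longleftrightarrow> x = y" "z1 = 0 \<longleftrightarrow> y = z" "x1 = n \<longleftrightarrow> z = 0"
    using step[OF xyz] by blast
  obtain x2 y2 z2 where 2: "vertex_cycle n (x1, y1, z1) = (x2, y2, z2)" "z2 \<le> y2" "y2 \<le> x2" "x2 \<le> n"
      "x2 = y2 \<longleftrightarrow> x1 = n" "y2 = z2 \<longleftrightarrow> x1 = y1" "z2 = 0 \<longleftrightarrow> y1 = z1" "x2 = n \<longleftrightarrow> z1 = 0"
    using step[OF 1(2-4)] by blast
  obtain x3 y3 z3 where 3: "vertex_cycle n (x2, y2, z2) = (x3, y3, z3)"
      "x3 = y3 \<longleftrightarrow> x2 = n" "y3 = z3 \<longleftrightarrow> x2 = y2" "z3 = 0 \<longleftrightarrow> y2 = z2" "x3 = n \<longleftrightarrow> z2 = 0"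
    using step[OF 2(2-4)] by blast
  \<comment> \<open>All four relations together would force \<open>n = 0\<close>; this excludes the
    case where \<open>lam\<close> has an arbitrary value.\<close>
  have "\<not> (x = y \<and> y = z \<and> z = 0 \<and> x = n)" using n by auto
  then show ?thesis
    unfolding 1(1) 2(1) 3(1) lam_eq cube_weight_def prod.case 3(2-5) 2(5-8) 1(5-8)
    by (cases "x = y"; cases "y = z"; cases "z = 0"; cases "x = n") (simp_all del: One_nat_def)
qed

text \<open>Every point of the cube is a reordering of a sorted one, and \<open>G\<close> does not
  see the order.\<close>

lemma sum_cube_symmetric:
  fixes G :: "nat \<Rightarrow> nat \<Rightarrow> nat \<Rightarrow> complex"
  assumes sym: "\<And>x y z. G y x z = G x y z" "\<And>x y z. G x z y = G x y z"
  shows "(\<Sum>(x, y, z)\<in>tri_index n. of_real (cube_weight n (x, y, z)) * G x y z)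
       = 4 * (\<Sum>x<n. \<Sum>y<n. \<Sum>z<n. G x y z)"
proof -
  \<comment> \<open>On sorted triples, the reciprocal of the number of coordinate permutations
    fixing the triple; hence the six reorderings of \<open>w\<close> add up to 1, ties
    included.\<close>
  define w :: "nat \<Rightarrow> nat \<Rightarrow> nat \<Rightarrow> complex" where
    "w x y z = (if z \<le> y \<and> y \<le> x then (if x = y \<and> y = z then 1/6 else if x = y \<or> y = z then 1/2 else 1) else 0)"
    for x y z
  define S where "S f = (\<Sum>x<n. \<Sum>y<n. \<Sum>z<n. f x y z * G x y z)" for f
  have S12: "S (\<lambda>x y z. f y x z) = S f" for f
    unfolding S_def by (subst sum.swap) (simp add: sym)
  have S23: "S (\<lambda>x y z. f x z y) = S f" for f
    unfolding S_def by (subst (2) sum.swap) (simp add: sym)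
  have part: "w x y z + w y x z + w x z y + w y z x + w z x y + w z y x = 1" for x y z
    unfolding w_def by (cases x y rule: linorder_cases; cases y z rule: linorder_cases;
        cases x z rule: linorder_cases) auto
  have "(\<Sum>x<n. \<Sum>y<n. \<Sum>z<n. G x y z)
      = S (\<lambda>x y z. w x y z + w y x z + w x z y + w y z x + w z x y + w z y x)"
    by (simp add: part S_def)
  also have "\<dots> = S w + S (\<lambda>x y z. w y x z) + S (\<lambda>x y z. w x z y) + S (\<lambda>x y z. w y z x)
      + S (\<lambda>x y z. w z x y) + S (\<lambda>x y z. w z y x)"
    by (simp add: S_def ring_distribs sum.distrib)
  also have "\<dots> = 6 * S w"
    using S12[of w] S23[of w] S12[of "\<lambda>x y z. w x z y"] S23[of "\<lambda>x y z. w y x z"]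
      S12[of "\<lambda>x y z. w z x y"] by simp
  also have "4 * \<dots> = 24 * S w" by simp
  also have "\<dots> = (\<Sum>(x, y, z)\<in>{..<n} \<times> {..<n} \<times> {..<n}. 24 * w x y z * G x y z)"
    by (simp add: S_def sum.cartesian_product sum_distrib_left mult.assoc case_prod_unfold)
  also have "\<dots> = (\<Sum>(x, y, z)\<in>tri_index n. of_real (cube_weight n (x, y, z)) * G x y z)"
    \<comment> \<open>The index sets differ only where a weight vanishes: \<open>w\<close> on
      unsorted triples, \<open>cube_weight\<close> on the face \<open>x = n\<close>.\<close>
    by (rule sum.mono_neutral_cong) (auto simp: w_def cube_weight_def split: if_splits)
  finally show ?thesis ..
qed

text \<open>A geometric sum whose ratio is an \<open>n\<close>-th root of unity other than
  1.\<close>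

lemma sum_cis_quarter_eq_0:
  assumes "4 dvd m" "\<not> 4 * int n dvd m"
  shows "(\<Sum>x<n. cis (pi / 2 * (of_int m * (real x / real n)))) = 0"
proof (cases "n = 0")
  case False
  define \<theta> where "\<theta> = pi / 2 * (of_int m / real n)"
  have "cis \<theta> \<noteq> 1"
  proof
    assume "cis \<theta> = 1"
    then obtain j :: int where "\<theta> = of_int j * 2 * pi"
      by (auto simp: complex_eq_iff cos_one_2pi_int)
    hence "real_of_int m = of_int (4 * int n * j)"
      using False by (simp add: \<theta>_def field_simps)
    hence "m = 4 * int n * j" by (simp only: of_int_eq_iff)
    thus False using assms(2) by simp
  qed
  moreover have "cis \<theta> ^ n = 1"
  proof -
    have "real n * \<theta> = pi / 2 * of_int m"
      using False by (simp add: \<theta>_def)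
    thus ?thesis
      using assms(1) by (simp only: Complex.DeMoivre cis_quarter_eq_1_iff)
  qed
  moreover have "cis (pi / 2 * (of_int m * (real x / real n))) = cis \<theta> ^ x" for x
    by (simp add: Complex.DeMoivre \<theta>_def field_simps)
  ultimately show ?thesis
    by (simp add: sum_gp_strict)
qed simp

text \<open>Divided by \<open>4n\<close>, the entries are decreasing integers with sum 0 and spread
  at most 1. A spread of exactly 1 would leave the sum nonzero modulo 4.\<close>

lemma TC_index_no_alias:
  assumes k: "k \<in> TC_index (2 * n - 1)" and n: "n \<ge> 1" and d: "\<And>i. 4 * int n dvd k $ i"
  shows "k = 0"
proof -
  have "\<forall>i. \<exists>c. k $ i = 4 * int n * c"
    using d by (auto elim: dvdE)
  then obtain c where c: "\<And>i. k $ i = 4 * int n * c i"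
    by metis
  have pos: "0 < 4 * int n" using n by simp
  \<comment> \<open>Strict because \<open>4(2n - 1) < 8n\<close>. Degree \<open>2n\<close> would
    admit the entries \<open>4n, 0, 0, -4n\<close>.\<close>
  have "4 * int n * (c 1 - c 4) < 4 * int n * 2"
    using k n by (simp add: TC_index_def c algebra_simps of_nat_diff)
  hence "c 1 - c 4 < 2" using pos by (simp only: mult_less_cancel_left_pos)
  moreover have "c 4 \<le> c 3" "c 3 \<le> c 2" "c 2 \<le> c 1"
    using k pos by (simp_all add: TC_index_def c)
  moreover have "4 * int n * (c 1 + c 2 + c 3 + c 4) = 0"
    using k by (simp add: TC_index_def HH_def c distrib_left)
  hence "c 1 + c 2 + c 3 + c 4 = 0" using pos by simp
  ultimately have "c 1 = 0 \<and> c 2 = 0 \<and> c 3 = 0 \<and> c 4 = 0" by presburger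
  thus ?thesis by (simp add: vec_eq_iff forall_4 c)
qed

lemma sum_triple_product:
  fixes c :: "'a :: comm_semiring_1"
  shows "(\<Sum>x\<in>A. \<Sum>y\<in>B. \<Sum>z\<in>C. c * (\<Sum>s\<in>P. f s x * g s y * h s z))
       = c * (\<Sum>s\<in>P. (\<Sum>x\<in>A. f s x) * (\<Sum>y\<in>B. g s y) * (\<Sum>z\<in>C. h s z))"
proof -
  have "(\<Sum>s\<in>P. (\<Sum>x\<in>A. f s x) * (\<Sum>y\<in>B. g s y) * (\<Sum>z\<in>C. h s z))
      = (\<Sum>s\<in>P. \<Sum>x\<in>A. \<Sum>y\<in>B. \<Sum>z\<in>C. f s x * g s y * h s z)"
    by (simp only: sum_distrib_left[symmetric] sum_distrib_right[symmetric])
  also have "\<dots> = (\<Sum>x\<in>A. \<Sum>y\<in>B. \<Sum>z\<in>C. \<Sum>s\<in>P. f s x * g s y * h s z)"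
    \<comment> \<open>Fixing the outer set as \<open>P\<close> makes the swap push that sum
      inwards.\<close>
    by (simp only: sum.swap[of _ _ P])
  finally show ?thesis by (simp add: sum_distrib_left)
qed

text \<open>Each permutation contributes a product of three geometric sums. If none of them
  vanished, \<open>4n\<close> would divide three entries of \<open>k\<close> and, by the zero sum,
  the fourth, forcing \<open>k = 0\<close>.\<close>

lemma sum_cube_TC_star:
  assumes k: "k \<in> TC_index (2 * n - 1)" and n: "n \<ge> 1" and d: "4 dvd k $ 4"
  shows "(\<Sum>x<n. \<Sum>y<n. \<Sum>z<n. TC_star k (real x / real n) (real y / real n) (real z / real n))
       = (if k = 0 then of_nat n ^ 3 else 0)"
proof (cases "k = 0")
  case True
  thus ?thesis by (simp add: TC_star_0 power3_eq_cube)
next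
  case False
  have kH: "k \<in> HH" using k by (simp add: TC_index_def)
  have d4: "4 dvd k $ i" for i
    using d HH_mod_4[OF kH, of i 4] by presburger
  define S where "S m = (\<Sum>x<n. cis (pi / 2 * (of_int m * (real x / real n))))" for m
  have zero: "S (k $ \<sigma> 1) * S (k $ \<sigma> 2) * S (k $ \<sigma> 3) = 0" if \<sigma>: "\<sigma> permutes UNIV" for \<sigma>
  proof (rule ccontr)
    assume "\<not> ?thesis"
    hence *: "4 * int n dvd k $ \<sigma> 1" "4 * int n dvd k $ \<sigma> 2" "4 * int n dvd k $ \<sigma> 3"
      using sum_cis_quarter_eq_0[of _ n] d4 unfolding S_def by fastforce+
    moreover have "k $ \<sigma> 4 = - (k $ \<sigma> 1 + k $ \<sigma> 2 + k $ \<sigma> 3)"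
      using HH_sum_permute[OF kH \<sigma>] by simp
    ultimately have "4 * int n dvd k $ \<sigma> 4" by simp
    with * have "\<forall>i. 4 * int n dvd k $ \<sigma> i" by (simp add: forall_4)
    hence "4 * int n dvd k $ i" for i
      using permutes_surj[OF \<sigma>] by (metis surjD)
    with TC_index_no_alias[OF k n] False show False by blast
  qed
  have "(\<Sum>x<n. \<Sum>y<n. \<Sum>z<n. TC_star k (real x / real n) (real y / real n) (real z / real n))
     = (1/24) * (\<Sum>\<sigma>\<in>{\<sigma>. \<sigma> permutes UNIV}. S (k $ \<sigma> 1) * S (k $ \<sigma> 2) * S (k $ \<sigma> 3))"
    unfolding TC_star_def distrib_left cis_mult[symmetric] S_def
    by (rule sum_triple_product)
  also have "\<dots> = 0"
    by (simp only: mult_eq_0_iff, rule disjI2, rule sum.neutral) (use zero in auto)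
  finally show ?thesis using False by simp
qed

lemma sum_lam_TC_node:
  assumes k: "k \<in> TC_index (2 * n - 1)" and n: "n \<ge> 1"
  shows "(\<Sum>(x, y, z)\<in>tri_index n. of_real (lam n x y z) * TC_node n k (x, y, z))
       = (if k = 0 then 4 * of_nat n ^ 3 else 0)"
proof -
  have kH: "k \<in> HH" using k by (simp add: TC_index_def)
  define L where "L = (\<lambda>(x, y, z). complex_of_real (lam n x y z))"
  define W where "W p = complex_of_real (cube_weight n p)" for p
  define F where "F = TC_node n k"
  define C where "C = vertex_cycle n"
  define \<omega> where "\<omega> = cis (pi / 2 * of_int (k $ 4))"
  have C_in: "C p \<in> tri_index n" if "p \<in> tri_index n" for p
    unfolding C_def by (rule vertex_cycle_in[OF that])
  have sum_C: "(\<Sum>p\<in>tri_index n. g (C p)) = (\<Sum>p\<in>tri_index n. g p)" for g :: "_ \<Rightarrow> complex"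
    unfolding C_def by (rule sum_vertex_cycle)
  have F_C: "F (C p) = \<omega> * F p" if "p \<in> tri_index n" for p
    unfolding F_def C_def \<omega>_def by (rule TC_node_vertex_cycle[OF kH n that])
  have L: "4 * L p = W p + W (C p) + W (C (C p)) + W (C (C (C p)))" if p: "p \<in> tri_index n" for p
  proof -
    obtain x y z where [simp]: "p = (x, y, z)" by (cases p)
    have "complex_of_real (4 * lam n x y z) = of_real (cube_weight n (x, y, z) + cube_weight n (vertex_cycle n (x, y, z))
     + cube_weight n (vertex_cycle n (vertex_cycle n (x, y, z)))
     + cube_weight n (vertex_cycle n (vertex_cycle n (vertex_cycle n (x, y, z)))))"
      using lam_eq_average[OF n, of x y z] p by (simp only: \<open>p = _\<close>)
    thus ?thesis by (simp add: L_def W_def C_def)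
  qed
  \<comment> \<open>The cycle has order 4, so moving from \<open>p\<close> to \<open>C p\<close>
    only rotates the four summands of the average.\<close>
  have L_C: "L (C p) = L p" if p: "p \<in> tri_index n" for p
  proof -
    have "4 * L (C p) = 4 * L p"
      using L[OF p] L[OF C_in[OF p]] vertex_cycle_4[OF p] by (simp add: C_def)
    thus ?thesis by simp
  qed
  have "(\<Sum>p\<in>tri_index n. L p * F p) = (if k = 0 then 4 * of_nat n ^ 3 else 0)"
  proof (cases "\<omega> = 1")
    case False
    have "(\<Sum>p\<in>tri_index n. L p * F p) = (\<Sum>p\<in>tri_index n. L (C p) * F (C p))"
      by (rule sum_C[symmetric])
    also have "\<dots> = (\<Sum>p\<in>tri_index n. \<omega> * (L p * F p))"
      by (rule sum.cong[OF refl]) (simp only: L_C F_C mult.left_commute)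
    also have "\<dots> = \<omega> * (\<Sum>p\<in>tri_index n. L p * F p)"
      by (simp add: sum_distrib_left)
    finally have "(\<omega> - 1) * (\<Sum>p\<in>tri_index n. L p * F p) = 0"
      by (simp only: left_diff_distrib mult_1 diff_self)
    hence "(\<Sum>p\<in>tri_index n. L p * F p) = 0"
      using False by (simp only: mult_eq_0_iff) simp
    moreover have "k \<noteq> 0" using False by (auto simp: \<omega>_def)
    ultimately show ?thesis by simp
  next
    case True
    define T where "T g = (\<Sum>p\<in>tri_index n. g p * F p)" for g
    \<comment> \<open>With \<open>\<omega> = 1\<close> the function \<open>F\<close> is constant
      along the cycle, so shifted weights have the same sum against \<open>F\<close>.\<close>
    have T_C: "T (\<lambda>p. g (C p)) = T g" for g
    proof -
      have "T (\<lambda>p. g (C p)) = (\<Sum>p\<in>tri_index n. g (C p) * F (C p))"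
        unfolding T_def by (rule sum.cong[OF refl]) (simp only: F_C True mult_1)
      thus ?thesis unfolding T_def by (simp only: sum_C[of "\<lambda>p. g p * F p"])
    qed
    have "4 * T L = (\<Sum>p\<in>tri_index n. (4 * L p) * F p)"
      by (simp add: T_def sum_distrib_left mult.assoc)
    also have "\<dots> = (\<Sum>p\<in>tri_index n. (W p + W (C p) + W (C (C p)) + W (C (C (C p)))) * F p)"
      by (rule sum.cong[OF refl]) (simp only: L)
    also have "\<dots> = T W + T (\<lambda>p. W (C p)) + T (\<lambda>p. W (C (C p))) + T (\<lambda>p. W (C (C (C p))))"
      by (simp add: T_def ring_distribs sum.distrib)
    also have "\<dots> = 4 * T W"
      using T_C[of W] T_C[of "\<lambda>p. W (C p)"] T_C[of "\<lambda>p. W (C (C p))"] by simp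
    finally have "T L = T W" by simp
    also have "T W = 4 * (\<Sum>x<n. \<Sum>y<n. \<Sum>z<n. TC_star k (real x / real n) (real y / real n) (real z / real n))"
      by (subst sum_cube_symmetric[symmetric])
        (simp_all add: T_def W_def F_def TC_node_def TC_star_swap12 TC_star_swap23 case_prod_unfold)
    also have "\<dots> = (if k = 0 then 4 * of_nat n ^ 3 else 0)"
      using True by (subst sum_cube_TC_star[OF k n]) (simp_all only: \<omega>_def cis_quarter_eq_1_iff, simp)
    finally show ?thesis by (simp add: T_def)
  qed
  thus ?thesis by (simp add: L_def F_def case_prod_unfold)
qed

section \<open>Integrals over the tetrahedron by symmetrization to the cube\<close>

lemma integral_permute_3:
  fixes h :: "real \<Rightarrow> real \<Rightarrow> real \<Rightarrow> complex" and i j l :: 3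
  assumes h: "integrable lborel (\<lambda>x::real^3. h (x $ 1) (x $ 2) (x $ 3))"
    and ijl: "distinct [i, j, l]"
  shows "integrable lborel (\<lambda>x::real^3. h (x $ i) (x $ j) (x $ l))"
    and "(\<integral>x. h (x $ i) (x $ j) (x $ l) \<partial>(lborel :: (real^3) measure))
       = (\<integral>x. h (x $ 1) (x $ 2) (x $ 3) \<partial>(lborel :: (real^3) measure))"
proof -
  define p :: "3 \<Rightarrow> 3" where "p a = (if a = 1 then i else if a = 2 then j else l)" for a
  have p123: "p 1 = i" "p 2 = j" "p 3 = l" by (simp_all add: p_def)
  have "\<forall>a b. p a = p b \<longrightarrow> a = b"
    unfolding forall_3 p123 using ijl by auto
  hence "inj p" by (simp add: inj_def)
  hence p: "p permutes UNIV"
    by (intro inj_imp_permutes) auto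
  have m: "(\<lambda>x. \<chi> i. x $ p i) \<in> measurable lborel (borel :: (real^3) measure)"
    by (auto intro!: borel_measurable_continuous_onI continuous_intros)
  have h': "(\<lambda>x::real^3. h (x $ 1) (x $ 2) (x $ 3)) \<in> borel_measurable borel"
    using borel_measurable_integrable[OF h] by simp
  show "integrable lborel (\<lambda>x::real^3. h (x $ i) (x $ j) (x $ l))"
    using integrable_distr_eq[OF m h'] h
    by (simp add: distr_lborel_permute_vec[OF p] p123)
  show "(\<integral>x. h (x $ i) (x $ j) (x $ l) \<partial>(lborel :: (real^3) measure))
       = (\<integral>x. h (x $ 1) (x $ 2) (x $ 3) \<partial>(lborel :: (real^3) measure))"
    using integral_distr[OF m h']
    by (simp add: distr_lborel_permute_vec[OF p] p123)
qed

text \<open>Ties lie in a hyperplane and are negligible, so the integral needs no analogue of the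
  fractional weights in the discrete sum.\<close>

lemma AE_lborel_coord_neq:
  assumes "i \<noteq> j"
  shows "AE x in (lborel :: (real^'n) measure). x $ i \<noteq> x $ j"
proof -
  have "negligible {x :: real^'n. (axis i 1 - axis j 1) \<bullet> x = 0}"
    using assms by (intro negligible_hyperplane) (simp add: axis_eq_axis)
  moreover have "{x :: real^'n. (axis i 1 - axis j 1) \<bullet> x = 0} = {x. x $ i = x $ j}"
    by (auto simp: inner_diff_left inner_axis')
  ultimately have "{x :: real^'n. x $ i = x $ j} \<in> null_sets lebesgue"
    by (simp add: negligible_iff_null_sets)
  \<comment> \<open>Being Borel turns a null set of \<open>lebesgue\<close> into a null set of
    \<open>lborel\<close>.\<close>
  moreover have "closed {x :: real^'n. x $ i = x $ j}"
    by (intro closed_Collect_eq continuous_intros)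
  ultimately have "{x :: real^'n. x $ i = x $ j} \<in> null_sets lborel"
    by (simp add: null_sets_completion_iff borel_closed)
  thus ?thesis by (rule AE_I') auto
qed

lemma compact_tri_star: "compact tri_star"
proof -
  have "closed tri_star"
    unfolding tri_star_def by (intro closed_Collect_conj closed_Collect_le continuous_intros)
  moreover have "tri_star \<subseteq> cbox 0 1"
    by (auto simp: tri_star_def mem_box_cart forall_3)
  ultimately show ?thesis
    using bounded_subset[OF bounded_cbox] by (auto simp: compact_eq_bounded_closed)
qed

text \<open>The six coordinate permutations of the tetrahedron tile the cube up to ties, and each
  copy contributes the same integral.\<close>

lemma integral_tri_star_symmetric:
  fixes G :: "real \<Rightarrow> real \<Rightarrow> real \<Rightarrow> complex"
  assumes sym: "\<And>x y z. G y x z = G x y z" "\<And>x y z. G x z y = G x y z"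
    and cont: "continuous_on UNIV (\<lambda>x::real^3. G (x $ 1) (x $ 2) (x $ 3))"
  shows "6 * (\<integral>x. indicator tri_star x *\<^sub>R G (x $ 1) (x $ 2) (x $ 3) \<partial>lborel)
       = (\<integral>x. indicator (cbox 0 1 :: (real^3) set) x *\<^sub>R G (x $ 1) (x $ 2) (x $ 3) \<partial>lborel)"
proof -
  define w :: "real \<Rightarrow> real \<Rightarrow> real \<Rightarrow> real" where
    "w x y z = of_bool (0 \<le> z \<and> z \<le> y \<and> y \<le> x \<and> x \<le> 1)" for x y z
  define H where "H x y z = w x y z *\<^sub>R G x y z" for x y z
  have tri: "indicator tri_star x = w (x $ 1) (x $ 2) (x $ 3)" for x
    by (simp add: tri_star_def w_def indicator_def)
  have int: "integrable lborel (\<lambda>x::real^3. H (x $ 1) (x $ 2) (x $ 3))"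
    using borel_integrable_compact[OF compact_tri_star continuous_on_subset[OF cont subset_UNIV]]
    by (simp add: tri H_def)
  have int_cube: "integrable lborel (\<lambda>x::real^3. indicator (cbox 0 1) x *\<^sub>R G (x $ 1) (x $ 2) (x $ 3))"
    by (rule borel_integrable_compact[OF compact_cbox continuous_on_subset[OF cont subset_UNIV]])
  note perm = integral_permute_3[of H, OF int]
  have H: "H y x z = w y x z *\<^sub>R G x y z" "H x z y = w x z y *\<^sub>R G x y z"
    "H y z x = w y z x *\<^sub>R G x y z" "H z x y = w z x y *\<^sub>R G x y z"
    "H z y x = w z y x *\<^sub>R G x y z" for x y z
    unfolding H_def by (metis sym)+
  have part: "w a b c + w b a c + w a c b + w b c a + w c a b + w c b a
      = of_bool (0 \<le> a \<and> a \<le> 1 \<and> 0 \<le> b \<and> b \<le> 1 \<and> 0 \<le> c \<and> c \<le> 1)"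
    if "a \<noteq> b" "b \<noteq> c" "a \<noteq> c" for a b c
    using that unfolding w_def
    by (cases a b rule: linorder_cases; cases b c rule: linorder_cases; cases a c rule: linorder_cases)
      auto
  have "AE x in (lborel :: (real^3) measure).
      indicator (cbox 0 1) x *\<^sub>R G (x $ 1) (x $ 2) (x $ 3)
      = H (x $ 1) (x $ 2) (x $ 3) + H (x $ 2) (x $ 1) (x $ 3) + H (x $ 1) (x $ 3) (x $ 2)
      + H (x $ 2) (x $ 3) (x $ 1) + H (x $ 3) (x $ 1) (x $ 2) + H (x $ 3) (x $ 2) (x $ 1)"
    using AE_lborel_coord_neq[of "1::3" 2, simplified] AE_lborel_coord_neq[of "2::3" 3, simplified]
      AE_lborel_coord_neq[of "1::3" 3, simplified]
  proof eventually_elim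
    case (elim x)
    have "indicator (cbox 0 1) x = w (x $ 1) (x $ 2) (x $ 3) + w (x $ 2) (x $ 1) (x $ 3)
       + w (x $ 1) (x $ 3) (x $ 2) + w (x $ 2) (x $ 3) (x $ 1) + w (x $ 3) (x $ 1) (x $ 2)
       + w (x $ 3) (x $ 2) (x $ 1)"
      using part[OF elim] by (simp add: indicator_def mem_box_cart forall_3 conj_ac)
    thus ?case
      unfolding H[where x="x $ 1" and y="x $ 2" and z="x $ 3"]
      by (simp only: scaleR_left_distrib) (simp only: H_def)
  qed
  moreover have "integrable lborel (\<lambda>x::real^3.
      H (x $ 1) (x $ 2) (x $ 3) + H (x $ 2) (x $ 1) (x $ 3) + H (x $ 1) (x $ 3) (x $ 2)
      + H (x $ 2) (x $ 3) (x $ 1) + H (x $ 3) (x $ 1) (x $ 2) + H (x $ 3) (x $ 2) (x $ 1))"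
    by (intro Bochner_Integration.integrable_add perm(1) int) simp_all
  ultimately have "(\<integral>x. indicator (cbox 0 1 :: (real^3) set) x *\<^sub>R G (x $ 1) (x $ 2) (x $ 3) \<partial>lborel)
     = (\<integral>x. H (x $ 1) (x $ 2) (x $ 3) + H (x $ 2) (x $ 1) (x $ 3) + H (x $ 1) (x $ 3) (x $ 2)
      + H (x $ 2) (x $ 3) (x $ 1) + H (x $ 3) (x $ 1) (x $ 2) + H (x $ 3) (x $ 2) (x $ 1)
        \<partial>(lborel :: (real^3) measure))"
    using int_cube by (intro integral_cong_AE borel_measurable_integrable)
  also have "\<dots> = 6 * (\<integral>x. H (x $ 1) (x $ 2) (x $ 3) \<partial>(lborel :: (real^3) measure))"
    by (subst Bochner_Integration.integral_add,
        intro Bochner_Integration.integrable_add perm(1) int, simp_all add: perm(1) int)+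
      (simp add: perm(2)[of 2 1 3] perm(2)[of 1 3 2] perm(2)[of 2 3 1] perm(2)[of 3 1 2] perm(2)[of 3 2 1])
  finally show ?thesis
    by (simp only: tri H_def)
qed

section \<open>One-dimensional exponential integrals and the integral of
  \<open>TC_star\<close>\<close>

lemma integral_cis_unit:
  "(\<integral>x. indicator {0..1} x *\<^sub>R cis (a * x) \<partial>lborel) = (if a = 0 then 1 else (cis a - 1) / (\<i> * a))"
proof (cases "a = 0")
  case False
  have "((\<lambda>x. exp (\<i> * a * of_real x) / (\<i> * a)) has_vector_derivative exp (\<i> * a * of_real x)) (at x within {0..1})" for x
  proof (rule has_vector_derivative_real_field)
    show "((\<lambda>z. exp (\<i> * a * z) / (\<i> * a)) has_field_derivative exp (\<i> * a * of_real x)) (at (of_real x))"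
      using False by (auto intro!: derivative_eq_intros)
  qed
  hence "((\<lambda>x. exp (\<i> * a * of_real x)) has_integral (exp (\<i> * a * of_real 1) / (\<i> * a) - exp (\<i> * a * of_real 0) / (\<i> * a))) {0..1}"
    by (intro fundamental_theorem_of_calculus) auto
  hence "((\<lambda>x. cis (a * x)) has_integral ((cis a - 1) / (\<i> * a))) {0..1}"
    by (simp add: cis_conv_exp diff_divide_distrib mult.assoc)
  moreover have "set_integrable lborel {0..1} (\<lambda>x. cis (a * x))"
    by (intro borel_integrable_atLeastAtMost' continuous_intros)
  ultimately show ?thesis
    using False by (simp add: set_borel_integral_eq_integral(2) set_lebesgue_integral_def[symmetric]
       integral_unique)
qed simp

text \<open>Composing with a transposition shows that the sum is the same for each of the four
  positions, while the four sums add up to 0.\<close>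

lemma sum_permutes_HH:
  assumes k: "k \<in> HH"
  shows "(\<Sum>\<sigma>\<in>{\<sigma>. \<sigma> permutes UNIV}. k $ \<sigma> 4) = 0"
proof -
  define s where "s j = (\<Sum>\<sigma>\<in>{\<sigma>. \<sigma> permutes UNIV}. k $ \<sigma> j)" for j
  have eq: "s j = s 4" for j
    unfolding s_def
    by (subst sum_permutations_compose_right[of "Transposition.transpose j 4"])
      (simp_all add: permutes_swap_id)
  have "s 1 + s 2 + s 3 + s 4 = 0"
    unfolding s_def by (simp add: HH_sum_permute[OF k] flip: sum.distrib)
  thus ?thesis
    unfolding eq[of 1] eq[of 2] eq[of 3] by (simp add: s_def)
qed

lemma sum_permutes_integral_cis:
  assumes k: "k \<in> HH" "k \<noteq> 0"
  defines "g \<equiv> \<lambda>m::int. \<integral>x. indicator {0..1} x *\<^sub>R cis (pi / 2 * of_int m * x) \<partial>lborel"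
  shows "(\<Sum>\<sigma>\<in>{\<sigma>. \<sigma> permutes UNIV}. g (k $ \<sigma> 1) * g (k $ \<sigma> 2) * g (k $ \<sigma> 3)) = 0"
proof (cases "4 dvd k $ 4")
  case True
  \<comment> \<open>An integral over a whole nonzero number of periods vanishes.\<close>
  have g: "g (k $ i) = 0 \<or> k $ i = 0" for i
  proof -
    have "4 dvd k $ i" using True HH_mod_4[OF k(1), of i 4] by presburger
    thus ?thesis
      using cis_quarter_eq_1_iff[of "k $ i"] unfolding g_def integral_cis_unit by simp
  qed
  have "g (k $ \<sigma> 1) * g (k $ \<sigma> 2) * g (k $ \<sigma> 3) = 0" if \<sigma>: "\<sigma> permutes UNIV" for \<sigma>
  proof (rule ccontr)
    assume "\<not> ?thesis"
    hence "k $ \<sigma> 1 = 0" "k $ \<sigma> 2 = 0" "k $ \<sigma> 3 = 0" using g by auto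
    with HH_sum_permute[OF k(1) \<sigma>] have "\<forall>i. k $ \<sigma> i = 0" by (simp add: forall_4)
    hence "k $ i = 0" for i using permutes_surj[OF \<sigma>] by (metis surjD)
    thus False using k(2) by (simp add: vec_eq_iff)
  qed
  thus ?thesis by (intro sum.neutral) auto
next
  case False
  \<comment> \<open>The numerator common to all one-dimensional integrals, since it depends only on
    the residue of the entry modulo 4.\<close>
  define c where "c = (cis (pi / 2 * of_int (k $ 4)) - 1) / (\<i> * of_real (pi / 2))"
  define P :: complex where "P = of_int (k $ 1) * of_int (k $ 2) * of_int (k $ 3) * of_int (k $ 4)"
  have nz: "k $ i \<noteq> 0" for i
    using False HH_mod_4[OF k(1), of i 4] by (metis dvd_0_right dvd_eq_mod_eq_0)
  have g: "g (k $ i) = c / of_int (k $ i)" for i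
    using nz[of i] cis_quarter_cong[OF HH_mod_4[OF k(1), of i 4]]
    unfolding g_def integral_cis_unit c_def by simp
  have prod: "(\<Prod>i\<in>UNIV. F i) = F 1 * F 2 * F 3 * F 4" for F :: "4 \<Rightarrow> complex"
    unfolding UNIV_4 by (simp add: ac_simps)
  \<comment> \<open>The product of three reciprocals is the omitted entry divided by
    \<open>P\<close>, and \<open>P\<close> is invariant under permutations.\<close>
  have "g (k $ \<sigma> 1) * g (k $ \<sigma> 2) * g (k $ \<sigma> 3) = c ^ 3 / P * of_int (k $ \<sigma> 4)"
    if \<sigma>: "\<sigma> permutes UNIV" for \<sigma>
  proof -
    have "P = of_int (k $ \<sigma> 1) * of_int (k $ \<sigma> 2) * of_int (k $ \<sigma> 3) * of_int (k $ \<sigma> 4)"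
      using prod.permute[OF \<sigma>, of "\<lambda>i. of_int (k $ i) :: complex"]
      by (simp add: P_def prod)
    thus ?thesis using nz by (simp add: g power3_eq_cube)
  qed
  hence "(\<Sum>\<sigma>\<in>{\<sigma>. \<sigma> permutes UNIV}. g (k $ \<sigma> 1) * g (k $ \<sigma> 2) * g (k $ \<sigma> 3))
      = (\<Sum>\<sigma>\<in>{\<sigma>. \<sigma> permutes UNIV}. c ^ 3 / P * of_int (k $ \<sigma> 4))"
    by (intro sum.cong) auto
  also have "\<dots> = c ^ 3 / P * of_int (\<Sum>\<sigma>\<in>{\<sigma>. \<sigma> permutes UNIV}. k $ \<sigma> 4)"
    by (simp only: sum_distrib_left of_int_sum)
  finally show ?thesis by (simp only: sum_permutes_HH[OF k(1)] of_int_0 mult_zero_right)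
qed

lemma integral_cube_cis:
  fixes a b c :: real
  shows "(\<integral>x. indicator (cbox 0 1 :: (real^3) set) x *\<^sub>R cis (pi / 2 * (a * x $ 1 + b * x $ 2 + c * x $ 3)) \<partial>lborel)
     = (\<integral>x. indicator {0..1} x *\<^sub>R cis (pi / 2 * a * x) \<partial>lborel)
     * (\<integral>x. indicator {0..1} x *\<^sub>R cis (pi / 2 * b * x) \<partial>lborel)
     * (\<integral>x. indicator {0..1} x *\<^sub>R cis (pi / 2 * c * x) \<partial>lborel)"
proof -
  define d :: "3 \<Rightarrow> real" where "d i = (if i = 1 then a else if i = 2 then b else c)" for i
  have d: "d 1 = a" "d 2 = b" "d 3 = c" by (simp_all add: d_def)
  define h where "h i t = indicator {0..1::real} t *\<^sub>R cis (pi / 2 * d i * t)" for i t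
  have prod: "(\<Prod>i\<in>UNIV. F i) = F 1 * F 2 * F 3" for F :: "3 \<Rightarrow> complex"
    unfolding UNIV_3 by (simp add: ac_simps)
  have "integrable lborel (h i)" for i
    unfolding h_def by (rule borel_integrable_compact) (auto intro!: continuous_intros)
  from integral_lborel_vec_prod[of h, OF this]
  have "(\<integral>x. (\<Prod>i\<in>UNIV. h i (x $ i)) \<partial>(lborel :: (real^3) measure))
     = (\<integral>x. h 1 x \<partial>lborel) * (\<integral>x. h 2 x \<partial>lborel) * (\<integral>x. h 3 x \<partial>lborel)"
    by (simp only: prod)
  moreover have "(\<Prod>i\<in>UNIV. h i (x $ i))
      = indicator (cbox 0 1) x *\<^sub>R cis (pi / 2 * (a * x $ 1 + b * x $ 2 + c * x $ 3))" for x :: "real^3"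
    unfolding prod h_def d by (auto simp: indicator_def mem_box_cart forall_3 cis_mult algebra_simps)
  ultimately show ?thesis
    by (simp add: h_def d)
qed

lemma continuous_on_TC_star:
  "continuous_on A (\<lambda>x::real^3. TC_star k (x $ 1) (x $ 2) (x $ 3))"
  unfolding TC_star_def by (intro continuous_intros)

text \<open>For \<open>k = 0\<close> the integrand is 1 and the value is the volume of the
  tetrahedron.\<close>

lemma has_integral_TC_star:
  assumes k: "k \<in> HH"
  shows "((\<lambda>x. TC_star k (x $ 1) (x $ 2) (x $ 3)) has_integral (if k = 0 then 1/6 else 0)) tri_star"
proof -
  define g where "g m = (\<integral>x. indicator {0..1} x *\<^sub>R cis (pi / 2 * of_int m * x) \<partial>lborel)" for m :: int
  define E where "E = (\<lambda>(\<sigma> :: 4 \<Rightarrow> 4) x. indicator (cbox 0 1 :: (real^3) set) x *\<^sub>R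
      cis (pi / 2 * (of_int (k $ \<sigma> 1) * x $ 1 + of_int (k $ \<sigma> 2) * x $ 2 + of_int (k $ \<sigma> 3) * x $ 3)))"
  have E: "integrable lborel (E \<sigma>)" for \<sigma>
    unfolding E_def by (intro borel_integrable_compact compact_cbox continuous_intros)
  have "6 * (\<integral>x. indicator tri_star x *\<^sub>R TC_star k (x $ 1) (x $ 2) (x $ 3) \<partial>lborel)
      = (\<integral>x. indicator (cbox 0 1 :: (real^3) set) x *\<^sub>R TC_star k (x $ 1) (x $ 2) (x $ 3) \<partial>lborel)"
    by (rule integral_tri_star_symmetric) (simp_all only: TC_star_swap12 TC_star_swap23 continuous_on_TC_star)
  also have "\<dots> = (\<integral>x. (1/24) * (\<Sum>\<sigma>\<in>{\<sigma>. \<sigma> permutes UNIV}. E \<sigma> x) \<partial>lborel)"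
    by (rule Bochner_Integration.integral_cong) (auto simp: TC_star_def E_def indicator_def)
  also have "\<dots> = (1/24) * (\<Sum>\<sigma>\<in>{\<sigma>. \<sigma> permutes UNIV}. \<integral>x. E \<sigma> x \<partial>lborel)"
    by (subst integral_mult_right_zero, subst Bochner_Integration.integral_sum) (simp_all add: E)
  also have "\<dots> = (1/24) * (\<Sum>\<sigma>\<in>{\<sigma>. \<sigma> permutes UNIV}. g (k $ \<sigma> 1) * g (k $ \<sigma> 2) * g (k $ \<sigma> 3))"
    unfolding E_def integral_cube_cis g_def ..
  also have "\<dots> = (if k = 0 then 1 else 0)"
  proof (cases "k = 0")
    case True
    have "g 0 = 1" unfolding g_def integral_cis_unit by simp
    moreover have "card {\<sigma>. \<sigma> permutes (UNIV :: 4 set)} = 24"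
      by (subst card_permutations[where n=4]) (simp_all add: fact_numeral)
    ultimately show ?thesis using True by simp
  next
    case False
    show ?thesis
      using False sum_permutes_integral_cis[OF k False] unfolding g_def by simp
  qed
  finally have val: "(LINT x:tri_star|lborel. TC_star k (x $ 1) (x $ 2) (x $ 3)) = (if k = 0 then 1/6 else 0)"
    by (cases "k = 0") (simp_all add: set_lebesgue_integral_def eq_divide_eq mult.commute)
  have int: "set_integrable lborel tri_star (\<lambda>x. TC_star k (x $ 1) (x $ 2) (x $ 3))"
    unfolding set_integrable_def
    by (rule borel_integrable_compact[OF compact_tri_star continuous_on_TC_star])
  show ?thesis
    unfolding has_integral_iff
    by (rule conjI[OF set_borel_integral_eq_integral(1)[OF int]
          trans[OF set_borel_integral_eq_integral(2)[OF int, symmetric] val]])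
qed

section \<open>From single cosines to their linear span\<close>

theorem theorem4p9:
  fixes n :: nat and f :: "real \<Rightarrow> real \<Rightarrow> real \<Rightarrow> complex"
  assumes "n \<ge> 1"
    and "\<exists>g\<in>TC_space (2 * n - 1).
           \<forall>t\<in>tri_H. f (t$1 - t$4) (t$2 - t$4) (t$3 - t$4) = g t"
  shows "(\<lambda>x. f (x$1) (x$2) (x$3)) integrable_on tri_star \<and>
         6 * integral tri_star (\<lambda>x. f (x$1) (x$2) (x$3)) =
         complex_of_real (1 / (4 * real n ^ 3)) *
           (\<Sum>(k1, k2, k3) \<in> {(k1, k2, k3). k3 \<le> k2 \<and> k2 \<le> k1 \<and> k1 \<le> n}.
              complex_of_real (lam n k1 k2 k3) * f (real k1 / real n) (real k2 / real n) (real k3 / real n))"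
proof -
  define I where "I = TC_index (2 * n - 1)"
  obtain c where c: "\<And>t. t \<in> tri_H \<Longrightarrow>
      f (t$1 - t$4) (t$2 - t$4) (t$3 - t$4) = (\<Sum>k\<in>I. c k * TC k t)"
    using assms(2) unfolding TC_space_def I_def by force
  have IH: "k \<in> HH" if "k \<in> I" for k using that by (simp add: I_def TC_index_def)
  have f: "f x y z = (\<Sum>k\<in>I. c k * TC_star k x y z)"
    if "0 \<le> z" "z \<le> y" "y \<le> x" "x \<le> 1" for x y z
  proof -
    \<comment> \<open>The shift by \<open>s\<close> makes the coordinates of \<open>t\<close> sum to
      0 and keeps the differences from \<open>t $ 4\<close> equal to \<open>x\<close>,
      \<open>y\<close>, \<open>z\<close>.\<close>
    define s where "s = (x + y + z) / 4"
    define t :: "real^4" where "t = (\<chi> i. if i = 1 then x - s else if i = 2 then y - s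
       else if i = 3 then z - s else - s)"
    have t: "t $ 1 = x - s" "t $ 2 = y - s" "t $ 3 = z - s" "t $ 4 = - s"
      by (simp_all add: t_def)
    have "t \<in> tri_H" using that by (simp add: tri_H_def RH_def t s_def field_simps)
    from c[OF this] show ?thesis by (simp add: t TC_eq_TC_star IH cong: sum.cong)
  qed
  \<comment> \<open>The coefficient of the constant function, to which both sides of the formula are
    equal.\<close>
  define v :: complex where "v = (\<Sum>k\<in>I. c k * (if k = 0 then 1 else 0))"
  have "((\<lambda>x. f (x$1) (x$2) (x$3)) has_integral (v / 6)) tri_star"
  \<comment> \<open>A \<open>sum\<close> over an infinite set is 0 by convention, so in that case
    \<open>f\<close> vanishes on the tetrahedron and \<open>v = 0\<close>. The split stands in for a
    proof that \<open>I\<close> is finite.\<close>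
  proof (cases "finite I")
    case True
    have "((\<lambda>x. \<Sum>k\<in>I. c k * TC_star k (x $ 1) (x $ 2) (x $ 3)) has_integral
        (\<Sum>k\<in>I. c k * (if k = 0 then 1/6 else 0))) tri_star"
      by (intro has_integral_sum has_integral_mult_right has_integral_TC_star True IH)
    moreover have "(\<Sum>k\<in>I. c k * (if k = 0 then 1/6 else 0)) = v / 6"
      unfolding v_def sum_divide_distrib by (intro sum.cong) auto
    ultimately show ?thesis
      by (auto intro: has_integral_eq[rotated] simp: f tri_star_def)
  next
    case False
    hence "((\<lambda>x. f (x$1) (x$2) (x$3)) has_integral 0) tri_star"
      by (intro has_integral_is_0) (auto simp: f tri_star_def)
    thus ?thesis using False by (simp add: v_def)
  qed
  moreover have "(\<Sum>(k1, k2, k3)\<in>tri_index n.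
      complex_of_real (lam n k1 k2 k3) * f (real k1 / real n) (real k2 / real n) (real k3 / real n))
      = 4 * of_nat n ^ 3 * v"
  proof -
    have "(\<Sum>(k1, k2, k3)\<in>tri_index n.
      complex_of_real (lam n k1 k2 k3) * f (real k1 / real n) (real k2 / real n) (real k3 / real n))
      = (\<Sum>(k1, k2, k3)\<in>tri_index n. \<Sum>k\<in>I. c k * (of_real (lam n k1 k2 k3) * TC_node n k (k1, k2, k3)))"
      using assms(1)
      by (intro sum.cong refl) (auto simp: f TC_node_def divide_simps sum_distrib_left mult.left_commute)
    also have "\<dots> = (\<Sum>k\<in>I. c k * (\<Sum>(k1, k2, k3)\<in>tri_index n. of_real (lam n k1 k2 k3) * TC_node n k (k1, k2, k3)))"
      by (simp add: case_prod_unfold sum_distrib_left sum.swap[of _ I])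
    also have "\<dots> = (\<Sum>k\<in>I. 4 * of_nat n ^ 3 * (c k * (if k = 0 then 1 else 0)))"
      using assms(1) by (intro sum.cong refl, subst sum_lam_TC_node) (auto simp: I_def)
    finally show ?thesis by (simp only: v_def sum_distrib_left)
  qed
  ultimately show ?thesis
    using assms(1) by (auto simp: integral_unique has_integral_integrable)
qed

end
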